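(* Let $f:\mathbb{R}^n\to\mathbb{R}$ be of class $C^2$, convex, $L$-smooth and bounded below, with $f^\star:=\inf f$ and $\phi(x_1):=f(x_1)-f^\star$. Consider the system $$\dot x_1=x_2,\qquad \dot x_2=u,\qquad \dot\xi=\nabla f(x_1),$$ with $x_1,x_2,\xi,u\in\mathbb{R}^n$. Let $a,k_d,k_i>0$ and $k_p\in\mathbb{R}$ be such that $$\rho:=k_p-ak_d-\frac{k_i}{a}>0 .$$ Put $\alpha(x_1,\xi):=-k_d\nabla f(x_1)-\frac{k_i}{a}\xi$, $e:=x_2-\alpha(x_1,\xi)=x_2+k_d\nabla f(x_1)+\frac{k_i}{a}\xi$, and $$V_1(x_1,\xi):=\rho\Bigl(\phi(x_1)+\frac{k_i}{2a}\|\xi\|^2\Bigr).$$ Then: (a) Along $\dot x_1=\alpha(x_1,\xi)+e$, $\dot\xi=\nabla f(x_1)$ one has $$\dot V_1=-\rho k_d\|\nabla f(x_1)\|^2+\rho\nabla f(x_1)^\top e .$$ Hence, with $c_\phi=\rho$, $c_z=\rho k_i/(2a)$, $\sigma=\rho k_d$, $\lambda=\rho$, the following conditions hold: $V_1(x_1,\xi)\ge c_\phi\phi(x_1)+c_z\|\xi\|^2$ for all $(x_1,\xi)$; $\dot V_1=-\sigma\|\nabla f(x_1)\|^2+\lambda\nabla f(x_1)^\top e$ along these dynamics; the map $(x_1,\xi)\mapsto\nabla f(x_1)$ is locally Lipschitz; and boundedness of $(\nabla f(x_1),\xi)$ implies boundedness of $\alpha(x_1,\xi)$. (b) If $u=\dot\alpha-ae-\rho\nabla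 f(x_1)$, where $\dot\alpha$ is the total derivative of $\alpha(x_1,\xi)$ along the system, then $$u=-ax_2-k_p\nabla f(x_1)-k_i\xi-k_d\nabla^2f(x_1)x_2 ,$$ and the corresponding second-order dynamics for $X=x_1$ (with $\xi(0)=0$) are $$\ddot X+a\dot X+k_p\nabla f(X)+k_i\int_0^t\nabla f(X(s))\,ds+k_d\frac{d}{dt}\nabla f(X)=0 .$$ (c) Consequently, along every closed-loop trajectory on $[0,\infty)$ of the system with the feedback in (b), $\nabla f(x_1(t))\to0$ as $t\to\infty$.
   Context: $\|\cdot\|$ is the Euclidean norm. $L$-smooth means $\|\nabla f(x)-\nabla f(y)\|\le L\|x-y\|$ for all $x,y\in\mathbb{R}^n$. A dot denotes the time derivative along trajectories. *)

theory Defs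
  imports "HOL-Analysis.Analysis"
begin

definition grad :: "(real ^ 'n \<Rightarrow> real) \<Rightarrow> real ^ 'n \<Rightarrow> real ^ 'n" where
  "grad f x = (THE D. GDERIV f x :> D)"

definition hessian :: "(real ^ 'n \<Rightarrow> real) \<Rightarrow> real ^ 'n \<Rightarrow> real ^ 'n ^ 'n" where
  "hessian f x = jacobian (grad f) (at x)"

definition class_C2 :: "(real ^ 'n \<Rightarrow> real) \<Rightarrow> bool" where
  "class_C2 f \<longleftrightarrow>
     (\<forall>x. f differentiable (at x)) \<and>
     (\<forall>x. grad f differentiable (at x)) \<and>
     continuous_on UNIV (hessian f)"

definition L_smooth :: "real \<Rightarrow> (real ^ 'n \<Rightarrow> real) \<Rightarrow> bool" where
  "L_smooth L f \<longleftrightarrow>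
     (\<forall>x. f differentiable (at x)) \<and>
     (\<forall>x y. norm (grad f x - grad f y) \<le> L * norm (x - y))"

definition gap :: "(real ^ 'n \<Rightarrow> real) \<Rightarrow> real ^ 'n \<Rightarrow> real" where
  "gap f x = f x - (INF y. f y)"

text \<open>The intervals \<open>[0, \<tau>)\<close>, \<open>[0, \<tau>]\<close> with \<open>\<tau> > 0\<close>, and \<open>[0, \<infinity>)\<close>. Time derivatives
  below are taken within such an interval, hence one-sided at its end points.\<close>

definition time_interval :: "real set \<Rightarrow> bool" where
  "time_interval T \<longleftrightarrow> is_interval T \<and> 0 \<in> T \<and> T \<subseteq> {0..} \<and> T \<noteq> {0}"

text \<open>Trajectories of \<open>x1' = x2\<close>, \<open>x2' = u\<close>, \<open>\<xi>' = \<nabla>f(x1)\<close>, with the input \<open>u\<close> a signal in time.\<close>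

definition system_trajectory ::
  "(real ^ 'n \<Rightarrow> real) \<Rightarrow> real set \<Rightarrow> (real \<Rightarrow> real ^ 'n) \<Rightarrow>
   (real \<Rightarrow> real ^ 'n) \<Rightarrow> (real \<Rightarrow> real ^ 'n) \<Rightarrow> (real \<Rightarrow> real ^ 'n) \<Rightarrow> bool" where
  "system_trajectory f T u x1 x2 \<xi> \<longleftrightarrow>
     (\<forall>t\<in>T. (x1 has_vector_derivative x2 t) (at t within T) \<and>
            (x2 has_vector_derivative u t) (at t within T) \<and>
            (\<xi> has_vector_derivative grad f (x1 t)) (at t within T))"

definition alpha ::
  "(real ^ 'n \<Rightarrow> real) \<Rightarrow> real \<Rightarrow> real \<Rightarrow> real \<Rightarrow> real ^ 'n \<Rightarrow> real ^ 'n \<Rightarrow> real ^ 'n" where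
  "alpha f a kd ki x1 \<xi> = - kd *\<^sub>R grad f x1 - (ki / a) *\<^sub>R \<xi>"

definition err ::
  "(real ^ 'n \<Rightarrow> real) \<Rightarrow> real \<Rightarrow> real \<Rightarrow> real \<Rightarrow>
   real ^ 'n \<Rightarrow> real ^ 'n \<Rightarrow> real ^ 'n \<Rightarrow> real ^ 'n" where
  "err f a kd ki x1 x2 \<xi> = x2 - alpha f a kd ki x1 \<xi>"

definition V1 ::
  "(real ^ 'n \<Rightarrow> real) \<Rightarrow> real \<Rightarrow> real \<Rightarrow> real \<Rightarrow> real ^ 'n \<Rightarrow> real ^ 'n \<Rightarrow> real" where
  "V1 f a ki \<rho> x1 \<xi> = \<rho> * (gap f x1 + ki / (2 * a) * (norm \<xi>)\<^sup>2)"

text \<open>Trajectories of \<open>x1' = \<alpha>(x1, \<xi>) + e\<close>, \<open>\<xi>' = \<nabla>f(x1)\<close>, with \<open>e\<close> an arbitrary signal in time.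
  Along \<^const>\<open>system_trajectory\<close> this is the \<open>(x1, \<xi>)\<close>-part, with \<open>e\<close> given by \<^const>\<open>err\<close>.\<close>

definition reduced_trajectory ::
  "(real ^ 'n \<Rightarrow> real) \<Rightarrow> real \<Rightarrow> real \<Rightarrow> real \<Rightarrow> real set \<Rightarrow>
   (real \<Rightarrow> real ^ 'n) \<Rightarrow> (real \<Rightarrow> real ^ 'n) \<Rightarrow> (real \<Rightarrow> real ^ 'n) \<Rightarrow> bool" where
  "reduced_trajectory f a kd ki T e x1 \<xi> \<longleftrightarrow>
     (\<forall>t\<in>T. (x1 has_vector_derivative alpha f a kd ki (x1 t) (\<xi> t) + e t) (at t within T) \<and>
            (\<xi> has_vector_derivative grad f (x1 t)) (at t within T))"

text \<open>The total derivative of \<open>\<alpha>(x1, \<xi>)\<close> along the system, as a function of the state: the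
  derivative of \<open>\<alpha>\<close> applied to \<open>(x1', \<xi>') = (x2, \<nabla>f(x1))\<close>. Since \<open>\<alpha>\<close> does not depend on
  \<open>x2\<close>, the input does not enter.\<close>

definition alpha_dot ::
  "(real ^ 'n \<Rightarrow> real) \<Rightarrow> real \<Rightarrow> real \<Rightarrow> real \<Rightarrow>
   real ^ 'n \<Rightarrow> real ^ 'n \<Rightarrow> real ^ 'n \<Rightarrow> real ^ 'n" where
  "alpha_dot f a kd ki x1 x2 \<xi> =
     frechet_derivative (\<lambda>(x, z). alpha f a kd ki x z) (at (x1, \<xi>)) (x2, grad f x1)"

definition feedback ::
  "(real ^ 'n \<Rightarrow> real) \<Rightarrow> real \<Rightarrow> real \<Rightarrow> real \<Rightarrow> real \<Rightarrow>
   real ^ 'n \<Rightarrow> real ^ 'n \<Rightarrow> real ^ 'n \<Rightarrow> real ^ 'n" where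
  "feedback f a kd ki \<rho> x1 x2 \<xi> =
     alpha_dot f a kd ki x1 x2 \<xi> - a *\<^sub>R err f a kd ki x1 x2 \<xi> - \<rho> *\<^sub>R grad f x1"

definition closed_loop_trajectory ::
  "(real ^ 'n \<Rightarrow> real) \<Rightarrow> real \<Rightarrow> real \<Rightarrow> real \<Rightarrow> real \<Rightarrow> real set \<Rightarrow>
   (real \<Rightarrow> real ^ 'n) \<Rightarrow> (real \<Rightarrow> real ^ 'n) \<Rightarrow> (real \<Rightarrow> real ^ 'n) \<Rightarrow> bool" where
  "closed_loop_trajectory f a kd ki \<rho> T x1 x2 \<xi> \<longleftrightarrow>
     system_trajectory f T (\<lambda>t. feedback f a kd ki \<rho> (x1 t) (x2 t) (\<xi> t)) x1 x2 \<xi>"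

text \<open>\<open>X'' + a X' + kp \<nabla>f(X) + ki \<integral>\<^sub>0\<^sup>t \<nabla>f(X(s)) ds + kd (d/dt) \<nabla>f(X) = 0\<close> on \<open>T\<close>. The derivatives
  \<open>X'\<close>, \<open>X''\<close> and \<open>G = (d/dt) \<nabla>f(X)\<close> and the integral are all required to exist.\<close>

definition pid_solution ::
  "(real ^ 'n \<Rightarrow> real) \<Rightarrow> real \<Rightarrow> real \<Rightarrow> real \<Rightarrow> real \<Rightarrow> real set \<Rightarrow>
   (real \<Rightarrow> real ^ 'n) \<Rightarrow> bool" where
  "pid_solution f a kp ki kd T X \<longleftrightarrow>
     (\<exists>X' X'' G. \<forall>t\<in>T.
        (X has_vector_derivative X' t) (at t within T) \<and>
        (X' has_vector_derivative X'' t) (at t within T) \<and>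
        ((\<lambda>s. grad f (X s)) has_vector_derivative G t) (at t within T) \<and>
        (\<lambda>s. grad f (X s)) integrable_on {0..t} \<and>
        X'' t + a *\<^sub>R X' t + kp *\<^sub>R grad f (X t)
          + ki *\<^sub>R integral {0..t} (\<lambda>s. grad f (X s)) + kd *\<^sub>R G t = 0)"

end

theory Submission
  imports Defs
begin

text \<open>
  The velocity error \<open>e = x2 - \<alpha>(x1, \<xi>)\<close> turns the closed loop into a backstepping system. Along
  \<open>x1' = \<alpha> + e\<close>, \<open>\<xi>' = \<nabla>f(x1)\<close> the weight \<open>k\<^sub>i / (2 a)\<close> of \<open>\<parallel>\<xi>\<parallel>\<^sup>2\<close> against the gap in \<open>V\<^sub>1\<close>
  is the one for which the cross terms \<open>\<nabla>f(x1) \<bullet> \<xi>\<close> cancel, which leaves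
  \<open>V\<^sub>1' = - \<rho> k\<^sub>d \<parallel>\<nabla>f\<parallel>\<^sup>2 + \<rho> \<nabla>f \<bullet> e\<close> (\<open>V1_derivative\<close>). The feedback makes
  \<open>e' = - a e - \<rho> \<nabla>f\<close>, so that the storage function \<open>W = V\<^sub>1 + \<parallel>e\<parallel>\<^sup>2 / 2\<close> loses the remaining
  indefinite term and satisfies \<open>W' = - \<rho> k\<^sub>d \<parallel>\<nabla>f\<parallel>\<^sup>2 - a \<parallel>e\<parallel>\<^sup>2\<close> (\<open>storage_derivative\<close>).
  The explicit form of the feedback is the chain rule for \<open>\<alpha>\<close>, and its equivalence with the
  second-order equation is the fundamental theorem of calculus for \<open>\<xi>\<close>.

  Convergence follows from the decay of \<open>W\<close>. Since \<open>W\<close> is bounded, so are \<open>f(x1) - f\<^sup>\<star>\<close>, \<open>\<xi>\<close> and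
  \<open>e\<close>. A single gradient step shows that the gradient of a smooth function is controlled by the gap
  (\<open>norm_grad_sq_le_gap\<close>), so \<open>\<nabla>f(x1)\<close> is bounded and with it the velocity \<open>x2 = \<alpha> + e\<close>. Hence
  \<open>t \<mapsto> \<nabla>f(x1(t))\<close> is Lipschitz. A Lipschitz signal that does not tend to zero stays away from
  zero on infinitely many intervals of a common length, and on each of them \<open>W\<close> would drop by a
  fixed amount; as \<open>W \<ge> 0\<close> this is impossible (\<open>dissipated_signal_tendsto_zero\<close>).
  The trajectory \<open>x1\<close> itself may be unbounded: minimizers need not exist.
\<close>

section \<open>Gradients and Hessians\<close>

text \<open>The gradient is a definite description, so that it has to be shown that a linear functional
  is represented by exactly one vector.\<close>

lemma grad_has_gderiv:
  assumes "f differentiable (at x)"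
  shows "GDERIV f x :> grad f x"
proof -
  have repr: "f' = (\<lambda>h. h \<bullet> (\<Sum>i\<in>Basis. f' i *\<^sub>R i))" if "linear f'" for f' :: "real ^ 'n \<Rightarrow> real"
  proof
    fix h
    have "f' h = f' (\<Sum>i\<in>Basis. (h \<bullet> i) *\<^sub>R i)"
      by (simp add: euclidean_representation)
    also have "\<dots> = (\<Sum>i\<in>Basis. (h \<bullet> i) * f' i)"
      using that by (simp add: linear_sum linear_scale)
    finally show "f' h = h \<bullet> (\<Sum>i\<in>Basis. f' i *\<^sub>R i)"
      by (simp add: inner_sum_right mult.commute)
  qed
  obtain f' where f': "(f has_derivative f') (at x)"
    using assms unfolding differentiable_def by blast
  define D where "D = (\<Sum>i\<in>Basis. f' i *\<^sub>R i)"
  have D: "GDERIV f x :> D"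
    using f' repr[OF has_derivative_linear[OF f']] unfolding gderiv_def D_def by (rule has_derivative_eq_rhs)
  have uniq: "E = D" if "GDERIV f x :> E" for E
  proof -
    have "(\<lambda>h. h \<bullet> E) = (\<lambda>h. h \<bullet> D)"
      using that D unfolding gderiv_def by (rule has_derivative_unique)
    then have "(E - D) \<bullet> E = (E - D) \<bullet> D"
      by (rule fun_cong)
    then have "(E - D) \<bullet> (E - D) = 0"
      by (simp add: inner_diff_right)
    then show ?thesis
      by simp
  qed
  show ?thesis
    unfolding grad_def using D uniq by (rule theI)
qed

lemma has_real_derivative_along_curve:
  assumes "f differentiable (at (x t))" "(x has_vector_derivative v) (at t within T)"
  shows "((\<lambda>s. f (x s)) has_real_derivative grad f (x t) \<bullet> v) (at t within T)"
proof -
  have "(f has_derivative (\<lambda>h. h \<bullet> grad f (x t))) (at (x t))"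
    using grad_has_gderiv[OF assms(1)] by (simp add: gderiv_def)
  then have "((\<lambda>s. f (x s)) has_derivative (\<lambda>h. (h *\<^sub>R v) \<bullet> grad f (x t))) (at t within T)"
    using assms(2) unfolding has_vector_derivative_def
    by (rule has_derivative_compose[rotated])
  then show ?thesis
    unfolding has_field_derivative_def
    by (rule has_derivative_eq_rhs) (auto simp: inner_commute)
qed

lemma grad_has_derivative:
  assumes "class_C2 f"
  shows "(grad f has_derivative (\<lambda>h. hessian f x *v h)) (at x)"
  using assms jacobian_works[of "grad f" "at x"] unfolding class_C2_def hessian_def by blast

lemma grad_has_vector_derivative_along_curve:
  assumes "class_C2 f" "(x has_vector_derivative v) (at t within T)"
  shows "((\<lambda>s. grad f (x s)) has_vector_derivative hessian f (x t) *v v) (at t within T)"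
proof -
  have "((\<lambda>s. grad f (x s)) has_derivative (\<lambda>h. hessian f (x t) *v (h *\<^sub>R v))) (at t within T)"
    using assms(2) grad_has_derivative[OF assms(1), of "x t"] unfolding has_vector_derivative_def
    by (rule has_derivative_compose)
  then show ?thesis
    unfolding has_vector_derivative_def by (simp add: matrix_vector_mult_scaleR)
qed

lemma norm_sq_has_real_derivative:
  fixes z :: "real \<Rightarrow> 'a::real_inner"
  assumes "(z has_vector_derivative v) (at t within T)"
  shows "((\<lambda>s. (norm (z s))\<^sup>2) has_real_derivative 2 * (z t \<bullet> v)) (at t within T)"
proof -
  have "((\<lambda>s. z s \<bullet> z s) has_derivative (\<lambda>h. z t \<bullet> (h *\<^sub>R v) + (h *\<^sub>R v) \<bullet> z t)) (at t within T)"
    using assms unfolding has_vector_derivative_def by (intro has_derivative_inner)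
  moreover have "(\<lambda>h. z t \<bullet> (h *\<^sub>R v) + (h *\<^sub>R v) \<bullet> z t) = (*) (2 * (z t \<bullet> v))"
    by (auto simp: inner_commute)
  ultimately show ?thesis
    unfolding has_field_derivative_def power2_norm_eq_inner by simp
qed

lemma L_smooth_mono:
  assumes "L_smooth L f" "L \<le> M"
  shows "L_smooth M f"
  using assms unfolding L_smooth_def by (meson mult_right_mono norm_ge_zero order_trans)

lemma local_lipschitz_grad:
  fixes f :: "real ^ 'n \<Rightarrow> real"
  assumes "L_smooth L f"
  shows "local_lipschitz (UNIV :: real set) UNIV (\<lambda>_ (x1, \<xi> :: real ^ 'n). grad f x1)"
proof (rule local_lipschitzI)
  have "\<bar>L\<bar>-lipschitz_on S (\<lambda>(x1, \<xi> :: real ^ 'n). grad f x1)" for S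
  proof (rule lipschitz_onI)
    fix p q :: "(real ^ 'n) \<times> (real ^ 'n)"
    have "dist (grad f (fst p)) (grad f (fst q)) \<le> L * dist (fst p) (fst q)"
      using assms by (simp add: L_smooth_def dist_norm)
    also have "\<dots> \<le> \<bar>L\<bar> * dist p q"
      by (intro mult_mono dist_fst_le) auto
    finally show "dist (case p of (x1, \<xi>) \<Rightarrow> grad f x1) (case q of (x1, \<xi>) \<Rightarrow> grad f x1)
        \<le> \<bar>L\<bar> * dist p q"
      by (simp add: case_prod_beta)
  qed simp
  then show "\<exists>u>0. \<exists>K. \<forall>t\<in>cball t u \<inter> UNIV.
      K-lipschitz_on (cball x u \<inter> UNIV) (\<lambda>(x1, \<xi> :: real ^ 'n). grad f x1)" for t :: real and x
    using zero_less_one by blast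
qed

lemma gap_nonneg:
  assumes "bdd_below (range f)"
  shows "gap f x \<ge> 0"
  using cINF_lower[OF assms, of x] by (simp add: gap_def)

text \<open>The gradient step from \<open>x\<close> to \<open>x - \<nabla>f(x) / (2 M)\<close> lowers the value of \<open>f\<close> by
  \<open>\<parallel>\<nabla>f(x)\<parallel>\<^sup>2 / (4 M)\<close> at least, and no value lies below \<open>inf f\<close>. The optimal constant is
  \<open>2 M\<close>; the weaker one needs the mean value theorem only.\<close>

lemma norm_grad_sq_le_gap:
  assumes smooth: "L_smooth M f" and "M > 0" and bdd: "bdd_below (range f)"
  shows "(norm (grad f x))\<^sup>2 \<le> 4 * M * gap f x"
proof -
  define g where "g = grad f x"
  define h where "h = 1 / (2 * M)"
  have "h > 0" using \<open>M > 0\<close> by (simp add: h_def)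
  have "((\<lambda>s. f (x - s *\<^sub>R g)) has_real_derivative grad f (x - s *\<^sub>R g) \<bullet> (- g)) (at s within {0..h})" for s
  proof (rule has_real_derivative_along_curve)
    show "f differentiable (at (x - s *\<^sub>R g))"
      using smooth by (simp add: L_smooth_def)
    show "((\<lambda>s. x - s *\<^sub>R g) has_vector_derivative - g) (at s within {0..h})"
      by (auto intro!: derivative_eq_intros)
  qed
  then obtain s where s: "s \<in> {0..h}"
    and drop: "f (x - h *\<^sub>R g) - f (x - 0 *\<^sub>R g) = (grad f (x - s *\<^sub>R g) \<bullet> (- g)) * (h - 0)"
    using mvt_very_simple[of 0 h "\<lambda>s. f (x - s *\<^sub>R g)" "\<lambda>s d. (grad f (x - s *\<^sub>R g) \<bullet> (- g)) * d"] \<open>h > 0\<close>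
    unfolding has_field_derivative_def by (metis less_eq_real_def)
  have "(g - grad f (x - s *\<^sub>R g)) \<bullet> g \<le> norm (g - grad f (x - s *\<^sub>R g)) * norm g"
    by (rule norm_cauchy_schwarz)
  also have "\<dots> \<le> (M * norm (x - (x - s *\<^sub>R g))) * norm g"
    using smooth unfolding L_smooth_def g_def by (metis mult_right_mono norm_ge_zero)
  also have "\<dots> = (M * s) * (norm g)\<^sup>2"
    using s by (simp add: power2_eq_square)
  also have "\<dots> \<le> (M * h) * (norm g)\<^sup>2"
    using s \<open>M > 0\<close> by (intro mult_right_mono mult_left_mono) auto
  also have "\<dots> = (norm g)\<^sup>2 / 2"
    using \<open>M > 0\<close> by (simp add: h_def)
  finally have "(norm g)\<^sup>2 / 2 \<le> grad f (x - s *\<^sub>R g) \<bullet> g"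
    by (simp add: inner_diff_left power2_norm_eq_inner)
  then have "h * ((norm g)\<^sup>2 / 2) \<le> h * (grad f (x - s *\<^sub>R g) \<bullet> g)"
    using \<open>h > 0\<close> by (intro mult_left_mono) auto
  also have "\<dots> = f x - f (x - h *\<^sub>R g)"
    using drop by (simp add: mult.commute)
  also have "\<dots> \<le> gap f x"
    using gap_nonneg[OF bdd, of "x - h *\<^sub>R g"] by (simp add: gap_def)
  finally have "(norm g)\<^sup>2 / (4 * M) \<le> gap f x"
    by (simp add: h_def)
  then show ?thesis
    using \<open>M > 0\<close> by (simp add: g_def field_simps)
qed

section \<open>Calculus on time intervals\<close>

lemma vector_derivative_unique_time_interval:
  assumes "time_interval T" "t \<in> T"
    and "(z has_vector_derivative v) (at t within T)" "(z has_vector_derivative w) (at t within T)"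
  shows "v = w"
proof -
  have "t islimpt T"
  proof (rule connected_imp_perfect)
    show "connected T"
      using assms(1) by (simp add: time_interval_def is_interval_connected)
    show "T \<noteq> {x}" for x
      using assms(1) unfolding time_interval_def by blast
    show "t \<in> T" by (fact assms(2))
  qed
  then have "at t within T \<noteq> bot"
    using trivial_limit_within by blast
  then show ?thesis
    using assms(3,4) by (rule vector_derivative_unique_within)
qed

lemma Icc_subset_time_interval:
  assumes "time_interval T" "t \<in> T"
  shows "{0..t} \<subseteq> T"
  using assms unfolding time_interval_def is_interval_1 by (meson atLeastAtMost_iff subsetI)

lemma integral_has_vector_derivative_time_interval:
  fixes g :: "real \<Rightarrow> 'a::banach"
  assumes T: "time_interval T" and "t \<in> T" and cont: "continuous_on T g"
  shows "((\<lambda>s. integral {0..s} g) has_vector_derivative g t) (at t within T)"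
proof -
  have "0 \<le> t" and nonneg: "T \<subseteq> {0..}"
    using T \<open>t \<in> T\<close> by (auto simp: time_interval_def)
  \<comment> \<open>Near \<open>t\<close>, the set \<open>T\<close> is a compact interval: one that ends at a later time of \<open>T\<close>, or, if
    there is none, \<open>T\<close> itself.\<close>
  obtain b where b: "b \<in> T" "t \<le> b" and eq: "at t within T = at t within {0..b}"
  proof (cases "\<exists>b\<in>T. t < b")
    case True
    then obtain b where "b \<in> T" "t < b" by blast
    then have "T \<inter> {..<b} - {t} = {0..b} \<inter> {..<b} - {t}"
      using Icc_subset_time_interval[OF T \<open>b \<in> T\<close>] nonneg by auto
    with \<open>t < b\<close> have "at t within T = at t within {0..b}"
      by (intro at_within_nhd[of t "{..<b}"]) auto
    then show ?thesis using that \<open>b \<in> T\<close> \<open>t < b\<close> by auto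
  next
    case False
    then have "T = {0..t}"
      using Icc_subset_time_interval[OF T \<open>t \<in> T\<close>] nonneg by force
    then show ?thesis using that \<open>t \<in> T\<close> by auto
  qed
  have "continuous_on {0..b} g"
    using cont Icc_subset_time_interval[OF T b(1)] by (rule continuous_on_subset)
  then show ?thesis
    unfolding eq using \<open>0 \<le> t\<close> b(2) by (intro integral_has_vector_derivative) auto
qed

lemma mean_value_half_line:
  fixes W :: "real \<Rightarrow> real"
  assumes der: "\<And>t. t \<ge> 0 \<Longrightarrow> (W has_real_derivative W' t) (at t within {0..})"
    and "0 \<le> s" "s \<le> t"
  shows "\<exists>r\<in>{s..t}. W t - W s = W' r * (t - s)"
proof (rule mvt_very_simple)
  fix r assume "s \<le> r" "r \<le> t"
  then have "(W has_real_derivative W' r) (at r within {s..t})"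
    using assms(2) by (intro DERIV_subset[OF der]) auto
  then show "(W has_derivative (*) (W' r)) (at r within {s..t})"
    by (simp add: has_field_derivative_def)
qed (fact assms(3))

lemma nonincreasing_half_line:
  fixes W :: "real \<Rightarrow> real"
  assumes der: "\<And>t. t \<ge> 0 \<Longrightarrow> (W has_real_derivative W' t) (at t within {0..})"
    and nonpos: "\<And>t. t \<ge> 0 \<Longrightarrow> W' t \<le> 0"
    and "0 \<le> s" "s \<le> t"
  shows "W t \<le> W s"
proof -
  obtain r where "r \<in> {s..t}" "W t - W s = W' r * (t - s)"
    using mean_value_half_line[OF der assms(3,4)] by blast
  then show ?thesis
    using nonpos[of r] assms(3,4) mult_nonpos_nonneg[of "W' r" "t - s"] by simp
qed

text \<open>A variant of Barbalat's lemma, with the dissipation inequality in the place of the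
  integrability of \<open>\<parallel>g\<parallel>\<^sup>2\<close>.\<close>

lemma dissipated_signal_tendsto_zero:
  fixes W :: "real \<Rightarrow> real" and g :: "real \<Rightarrow> 'a::real_normed_vector"
  assumes der: "\<And>t. t \<ge> 0 \<Longrightarrow> (W has_real_derivative W' t) (at t within {0..})"
    and diss: "\<And>t. t \<ge> 0 \<Longrightarrow> W' t \<le> - c * (norm (g t))\<^sup>2" and "c > 0"
    and bdd: "bdd_below (W ` {0..})"
    and lip: "K-lipschitz_on {0..} g"
  shows "(g \<longlongrightarrow> 0) at_top"
proof (rule tendstoI)
  fix \<epsilon> :: real
  assume "\<epsilon> > 0"
  have "K \<ge> 0" using lip by (simp add: lipschitz_on_def)
  \<comment> \<open>If \<open>\<parallel>g\<parallel> \<ge> \<epsilon>\<close> at some time, then \<open>\<parallel>g\<parallel> \<ge> \<epsilon> / 2\<close> during the following period of length \<open>h\<close>,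
    and \<open>W\<close> drops by \<open>\<delta>\<close> at least. The summand \<open>1\<close> covers \<open>K = 0\<close>.\<close>
  define h where "h = \<epsilon> / (2 * (K + 1))"
  define \<delta> where "\<delta> = c * (\<epsilon> / 2)\<^sup>2 * h"
  have "h > 0" and Kh: "K * h \<le> \<epsilon> / 2"
    using \<open>\<epsilon> > 0\<close> \<open>K \<ge> 0\<close> by (auto simp: h_def field_simps)
  then have "\<delta> > 0"
    using \<open>c > 0\<close> \<open>\<epsilon> > 0\<close> by (simp add: \<delta>_def)
  \<comment> \<open>From the time \<open>t0\<close> on, \<open>W\<close> has less than \<open>\<delta>\<close> left to lose.\<close>
  have "\<exists>w\<in>W ` {0..}. w < Inf (W ` {0..}) + \<delta>"
    using \<open>\<delta> > 0\<close> by (intro cInf_lessD) auto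
  then obtain t0 where t0: "t0 \<ge> 0" "W t0 < Inf (W ` {0..}) + \<delta>"
    by auto
  have "norm (g t) < \<epsilon>" if "t \<ge> t0" for t
  proof (rule ccontr)
    assume "\<not> norm (g t) < \<epsilon>"
    have "\<exists>r\<in>{t..t + h}. W (t + h) - W t = W' r * (t + h - t)"
      using t0(1) that \<open>h > 0\<close> by (intro mean_value_half_line[OF der]) auto
    then obtain r where r: "r \<in> {t..t + h}" "W (t + h) - W t = W' r * h"
      by (metis add_diff_cancel_left')
    have "norm (g t - g r) \<le> K * \<bar>t - r\<bar>"
      using lipschitz_onD[OF lip, of t r] t0(1) that r(1) by (auto simp: dist_norm)
    also have "\<dots> \<le> K * h"
      using r(1) \<open>K \<ge> 0\<close> by (intro mult_left_mono) auto
    finally have "\<epsilon> / 2 \<le> norm (g r)"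
      using Kh \<open>\<not> norm (g t) < \<epsilon>\<close> norm_triangle_ineq2[of "g t" "g r"] by linarith
    then have "c * (\<epsilon> / 2)\<^sup>2 \<le> c * (norm (g r))\<^sup>2"
      using \<open>c > 0\<close> \<open>\<epsilon> > 0\<close> by (intro mult_left_mono power_mono) auto
    then have "W' r \<le> - (c * (\<epsilon> / 2)\<^sup>2)"
      using diss[of r] r(1) t0(1) that by auto
    then have "W' r * h \<le> - (c * (\<epsilon> / 2)\<^sup>2) * h"
      using \<open>h > 0\<close> by (intro mult_right_mono) auto
    then have "W (t + h) \<le> W t - \<delta>"
      using r(2) by (simp add: \<delta>_def)
    moreover have "W t \<le> W t0"
    proof (rule nonincreasing_half_line[OF der _ t0(1) that])
      fix r :: real assume "r \<ge> 0"
      moreover have "0 \<le> c * (norm (g r))\<^sup>2"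
        using \<open>c > 0\<close> by simp
      ultimately show "W' r \<le> 0"
        using diss[of r] by simp
    qed
    moreover have "Inf (W ` {0..}) \<le> W (t + h)"
      using bdd t0(1) that \<open>h > 0\<close> by (intro cInf_lower) auto
    ultimately show False
      using t0(2) by linarith
  qed
  then show "\<forall>\<^sub>F t in at_top. dist (g t) 0 < \<epsilon>"
    unfolding eventually_at_top_linorder by auto
qed

section \<open>The feedback in explicit form\<close>

lemma alpha_dot_eq:
  assumes "class_C2 f"
  shows "alpha_dot f a kd ki x1 x2 \<xi> = - kd *\<^sub>R (hessian f x1 *v x2) - (ki / a) *\<^sub>R grad f x1"
proof -
  have "((\<lambda>p. grad f (fst p)) has_derivative (\<lambda>p. hessian f x1 *v fst p)) (at (x1, \<xi>))"
    by (rule has_derivative_compose[where f = fst]) 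
      (auto intro!: derivative_eq_intros grad_has_derivative assms)
  then have "((\<lambda>p. - kd *\<^sub>R grad f (fst p) - (ki / a) *\<^sub>R snd p) has_derivative
      (\<lambda>p. - kd *\<^sub>R (hessian f x1 *v fst p) - (ki / a) *\<^sub>R snd p)) (at (x1, \<xi>))"
    by (intro derivative_intros)
  then have "((\<lambda>(x, z). alpha f a kd ki x z) has_derivative
      (\<lambda>p. - kd *\<^sub>R (hessian f x1 *v fst p) - (ki / a) *\<^sub>R snd p)) (at (x1, \<xi>))"
    by (simp add: alpha_def case_prod_unfold)
  from frechet_derivative_at[OF this, symmetric] show ?thesis
    by (simp add: alpha_dot_def)
qed

lemma alpha_has_vector_derivative:
  assumes "class_C2 f"
    and "(x1 has_vector_derivative x2 t) (at t within T)"
    and "(\<xi> has_vector_derivative grad f (x1 t)) (at t within T)"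
  shows "((\<lambda>s. alpha f a kd ki (x1 s) (\<xi> s)) has_vector_derivative
           alpha_dot f a kd ki (x1 t) (x2 t) (\<xi> t)) (at t within T)"
  unfolding alpha_dot_eq[OF assms(1)] alpha_def
  using grad_has_vector_derivative_along_curve[OF assms(1,2)] assms(3)
  by (auto intro!: derivative_eq_intros)

lemma feedback_eq:
  assumes "class_C2 f" "a > 0" "\<rho> = kp - a * kd - ki / a"
  shows "feedback f a kd ki \<rho> x1 x2 \<xi> =
    - a *\<^sub>R x2 - kp *\<^sub>R grad f x1 - ki *\<^sub>R \<xi> - kd *\<^sub>R (hessian f x1 *v x2)"
  using assms(2)
  by (simp add: feedback_def alpha_dot_eq[OF assms(1)] err_def alpha_def assms(3) algebra_simps)

text \<open>On a closed-loop trajectory that starts with \<open>\<xi>(0) = 0\<close>, the state \<open>\<xi>\<close> is the integral of the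
  gradient, and the Hessian term of the feedback is \<open>- k\<^sub>d\<close> times the time derivative of the
  gradient. The
  converse direction also relies on the uniqueness of this derivative on the time interval.\<close>

lemma closed_loop_iff_pid_solution:
  assumes C2: "class_C2 f" and "a > 0" and \<rho>: "\<rho> = kp - a * kd - ki / a"
    and T: "time_interval T"
  shows "(\<exists>x2 \<xi>. closed_loop_trajectory f a kd ki \<rho> T X x2 \<xi> \<and> \<xi> 0 = 0) \<longleftrightarrow>
    pid_solution f a kp ki kd T X"
proof
  assume "\<exists>x2 \<xi>. closed_loop_trajectory f a kd ki \<rho> T X x2 \<xi> \<and> \<xi> 0 = 0"
  then obtain x2 \<xi> where \<xi>0: "\<xi> 0 = 0"
    and X: "\<And>t. t \<in> T \<Longrightarrow> (X has_vector_derivative x2 t) (at t within T)"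
    and x2: "\<And>t. t \<in> T \<Longrightarrow>
      (x2 has_vector_derivative feedback f a kd ki \<rho> (X t) (x2 t) (\<xi> t)) (at t within T)"
    and \<xi>: "\<And>t. t \<in> T \<Longrightarrow> (\<xi> has_vector_derivative grad f (X t)) (at t within T)"
    unfolding closed_loop_trajectory_def system_trajectory_def by blast
  have int: "((\<lambda>s. grad f (X s)) has_integral \<xi> t) {0..t}" if "t \<in> T" for t
  proof -
    have "((\<lambda>s. grad f (X s)) has_integral (\<xi> t - \<xi> 0)) {0..t}"
    proof (rule fundamental_theorem_of_calculus)
      show "0 \<le> t" using T that by (auto simp: time_interval_def)
      show "(\<xi> has_vector_derivative grad f (X s)) (at s within {0..t})" if "s \<in> {0..t}" for s
        using Icc_subset_time_interval[OF T \<open>t \<in> T\<close>] \<xi> that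
        by (meson has_vector_derivative_within_subset subsetD)
    qed
    then show ?thesis by (simp add: \<xi>0)
  qed
  show "pid_solution f a kp ki kd T X"
    unfolding pid_solution_def
  proof (intro exI ballI conjI)
    fix t assume t: "t \<in> T"
    show "(X has_vector_derivative x2 t) (at t within T)" by (rule X[OF t])
    show "(x2 has_vector_derivative feedback f a kd ki \<rho> (X t) (x2 t) (\<xi> t)) (at t within T)"
      by (rule x2[OF t])
    show "((\<lambda>s. grad f (X s)) has_vector_derivative hessian f (X t) *v x2 t) (at t within T)"
      by (rule grad_has_vector_derivative_along_curve[OF C2 X[OF t]])
    show "(\<lambda>s. grad f (X s)) integrable_on {0..t}"
      using int[OF t] by blast
    show "feedback f a kd ki \<rho> (X t) (x2 t) (\<xi> t) + a *\<^sub>R x2 t + kp *\<^sub>R grad f (X t)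
        + ki *\<^sub>R integral {0..t} (\<lambda>s. grad f (X s)) + kd *\<^sub>R (hessian f (X t) *v x2 t) = 0"
      using integral_unique[OF int[OF t]]
      by (simp add: feedback_eq[OF C2 \<open>a > 0\<close> \<rho>])
  qed
next
  assume "pid_solution f a kp ki kd T X"
  then obtain X' X'' G where
    X: "\<And>t. t \<in> T \<Longrightarrow> (X has_vector_derivative X' t) (at t within T)"
    and X': "\<And>t. t \<in> T \<Longrightarrow> (X' has_vector_derivative X'' t) (at t within T)"
    and G: "\<And>t. t \<in> T \<Longrightarrow> ((\<lambda>s. grad f (X s)) has_vector_derivative G t) (at t within T)"
    and ode: "\<And>t. t \<in> T \<Longrightarrow> X'' t + a *\<^sub>R X' t + kp *\<^sub>R grad f (X t)
          + ki *\<^sub>R integral {0..t} (\<lambda>s. grad f (X s)) + kd *\<^sub>R G t = 0"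
    unfolding pid_solution_def by blast
  define \<xi> where "\<xi> t = integral {0..t} (\<lambda>s. grad f (X s))" for t
  have G_eq: "G t = hessian f (X t) *v X' t" if "t \<in> T" for t
    using vector_derivative_unique_time_interval[OF T that G[OF that]
        grad_has_vector_derivative_along_curve[OF C2 X[OF that]]] .
  have cont: "continuous_on T (\<lambda>s. grad f (X s))"
    using G by (rule continuous_on_vector_derivative)
  have X''_eq: "X'' t = feedback f a kd ki \<rho> (X t) (X' t) (\<xi> t)" if "t \<in> T" for t
  proof -
    have "X'' t = - (a *\<^sub>R X' t + kp *\<^sub>R grad f (X t) + ki *\<^sub>R \<xi> t + kd *\<^sub>R (hessian f (X t) *v X' t))"
      using ode[OF that] unfolding eq_neg_iff_add_eq_0 \<xi>_def G_eq[OF that] by (simp only: add.assoc)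
    then show ?thesis
      by (simp add: feedback_eq[OF C2 \<open>a > 0\<close> \<rho>])
  qed
  have "closed_loop_trajectory f a kd ki \<rho> T X X' \<xi>"
    unfolding closed_loop_trajectory_def system_trajectory_def
  proof (intro ballI conjI)
    fix t assume t: "t \<in> T"
    show "(X has_vector_derivative X' t) (at t within T)" by (rule X[OF t])
    show "(X' has_vector_derivative feedback f a kd ki \<rho> (X t) (X' t) (\<xi> t)) (at t within T)"
      using X'[OF t] by (simp add: X''_eq[OF t])
    show "(\<xi> has_vector_derivative grad f (X t)) (at t within T)"
      unfolding \<xi>_def using integral_has_vector_derivative_time_interval[OF T t cont] .
  qed
  moreover have "\<xi> 0 = 0" by (simp add: \<xi>_def)
  ultimately show "\<exists>x2 \<xi>. closed_loop_trajectory f a kd ki \<rho> T X x2 \<xi> \<and> \<xi> 0 = 0"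
    by blast
qed

section \<open>Dissipation\<close>

lemma V1_derivative:
  assumes C2: "class_C2 f" and "a > 0"
    and traj: "reduced_trajectory f a kd ki T e x1 \<xi>" and t: "t \<in> T"
  shows "((\<lambda>s. V1 f a ki \<rho> (x1 s) (\<xi> s)) has_real_derivative
    - \<rho> * kd * (norm (grad f (x1 t)))\<^sup>2 + \<rho> * (grad f (x1 t) \<bullet> e t)) (at t within T)"
proof -
  have x1: "(x1 has_vector_derivative alpha f a kd ki (x1 t) (\<xi> t) + e t) (at t within T)"
    and \<xi>: "(\<xi> has_vector_derivative grad f (x1 t)) (at t within T)"
    using traj t by (auto simp: reduced_trajectory_def)
  have f: "((\<lambda>s. f (x1 s)) has_real_derivative
      grad f (x1 t) \<bullet> (alpha f a kd ki (x1 t) (\<xi> t) + e t)) (at t within T)"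
    using C2 x1 by (intro has_real_derivative_along_curve) (auto simp: class_C2_def)
  have "((\<lambda>s. \<rho> * (f (x1 s) - (INF y. f y) + ki / (2 * a) * (norm (\<xi> s))\<^sup>2)) has_real_derivative
      \<rho> * (grad f (x1 t) \<bullet> (alpha f a kd ki (x1 t) (\<xi> t) + e t)
        + ki / (2 * a) * (2 * (\<xi> t \<bullet> grad f (x1 t))))) (at t within T)"
    by (rule DERIV_cong[OF DERIV_cmult[OF DERIV_add[OF DERIV_diff[OF f DERIV_const]
            DERIV_cmult[OF norm_sq_has_real_derivative[OF \<xi>]]]]]) simp
  moreover have "\<rho> * (grad f (x1 t) \<bullet> (alpha f a kd ki (x1 t) (\<xi> t) + e t)
        + ki / (2 * a) * (2 * (\<xi> t \<bullet> grad f (x1 t))))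
      = - \<rho> * kd * (norm (grad f (x1 t)))\<^sup>2 + \<rho> * (grad f (x1 t) \<bullet> e t)"
    using \<open>a > 0\<close>
    by (simp add: alpha_def inner_add_right inner_diff_right power2_norm_eq_inner
        inner_commute[of "\<xi> t"] algebra_simps)
  ultimately show ?thesis
    unfolding V1_def gap_def by simp
qed

text \<open>The term \<open>- \<rho> \<nabla>f\<close> of the feedback cancels the indefinite term of \<open>V\<^sub>1'\<close>, and \<open>- a e\<close> damps the
  error.\<close>

lemma storage_derivative:
  assumes C2: "class_C2 f" and "a > 0"
    and traj: "closed_loop_trajectory f a kd ki \<rho> T x1 x2 \<xi>" and t: "t \<in> T"
  shows "((\<lambda>s. V1 f a ki \<rho> (x1 s) (\<xi> s) + (norm (err f a kd ki (x1 s) (x2 s) (\<xi> s)))\<^sup>2 / 2)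
    has_real_derivative - (\<rho> * kd) * (norm (grad f (x1 t)))\<^sup>2
      - a * (norm (err f a kd ki (x1 t) (x2 t) (\<xi> t)))\<^sup>2) (at t within T)"
proof -
  define e where "e s = err f a kd ki (x1 s) (x2 s) (\<xi> s)" for s
  have "reduced_trajectory f a kd ki T e x1 \<xi>"
    using traj unfolding closed_loop_trajectory_def system_trajectory_def
    by (simp add: reduced_trajectory_def e_def err_def)
  note V1 = V1_derivative[OF C2 \<open>a > 0\<close> this t, of \<rho>]
  have "(e has_vector_derivative feedback f a kd ki \<rho> (x1 t) (x2 t) (\<xi> t)
      - alpha_dot f a kd ki (x1 t) (x2 t) (\<xi> t)) (at t within T)"
    using traj t unfolding closed_loop_trajectory_def system_trajectory_def e_def[abs_def] err_def
    by (intro has_vector_derivative_diff alpha_has_vector_derivative C2) auto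
  then have "(e has_vector_derivative - a *\<^sub>R e t - \<rho> *\<^sub>R grad f (x1 t)) (at t within T)"
    by (simp add: feedback_def e_def)
  from DERIV_add[OF V1 DERIV_cdivide[OF norm_sq_has_real_derivative[OF this], of 2]]
  have "((\<lambda>s. V1 f a ki \<rho> (x1 s) (\<xi> s) + (norm (e s))\<^sup>2 / 2) has_real_derivative
      - (\<rho> * kd) * (norm (grad f (x1 t)))\<^sup>2 - a * (norm (e t))\<^sup>2) (at t within T)"
    by (rule DERIV_cong)
      (simp add: inner_diff_right power2_norm_eq_inner inner_commute diff_divide_distrib algebra_simps)
  then show ?thesis
    by (simp only: e_def)
qed

section \<open>Boundedness and convergence\<close>

lemma bounded_alpha:
  assumes "bounded ((\<lambda>(x1, \<xi>). (grad f x1, \<xi>)) ` S)"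
  shows "bounded ((\<lambda>(x1, \<xi>). alpha f a kd ki x1 \<xi>) ` S)"
proof -
  have "bounded ((\<lambda>p. grad f (fst p)) ` S)" "bounded (snd ` S)"
    using bounded_fst[OF assms] bounded_snd[OF assms]
    by (simp_all add: image_image case_prod_beta)
  then have "bounded ((\<lambda>p. (- kd) *\<^sub>R grad f (fst p) - (ki / a) *\<^sub>R snd p) ` S)"
    by (intro bounded_minus_comp bounded_scaleR_comp)
  then show ?thesis
    by (simp add: alpha_def case_prod_beta)
qed

lemma bounded_image_if_norm_sq_le:
  assumes "\<And>t. t \<in> S \<Longrightarrow> (norm (z t))\<^sup>2 \<le> B"
  shows "bounded (z ` S)"
  using assms real_le_rsqrt by (intro boundedI[where B = "sqrt B"]) blast

text \<open>The storage function is a sum of nonnegative terms, each of which is therefore at most the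
  initial value of the sum. This bounds
  \<open>\<xi>\<close>, \<open>e\<close> and the gap, hence also the gradient and the velocity.\<close>

lemma closed_loop_velocity_bounded:
  assumes C2: "class_C2 f" and smooth: "L_smooth M f" and "M > 0" and bdd: "bdd_below (range f)"
    and pos: "a > 0" "kd > 0" "ki > 0" "\<rho> > 0"
    and traj: "closed_loop_trajectory f a kd ki \<rho> {0..} x1 x2 \<xi>"
  shows "bounded (x2 ` {0..})"
proof -
  define e where "e s = err f a kd ki (x1 s) (x2 s) (\<xi> s)" for s
  define W where "W s = V1 f a ki \<rho> (x1 s) (\<xi> s) + (norm (e s))\<^sup>2 / 2" for s
  have W_le: "\<rho> * gap f (x1 t) + \<rho> * ki / (2 * a) * (norm (\<xi> t))\<^sup>2 + (norm (e t))\<^sup>2 / 2 \<le> W 0"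
    if "t \<ge> 0" for t
  proof -
    have "W t \<le> W 0"
    proof (rule nonincreasing_half_line[OF _ _ order_refl that])
      fix s :: real assume "s \<ge> 0"
      then show "(W has_real_derivative
          - (\<rho> * kd) * (norm (grad f (x1 s)))\<^sup>2 - a * (norm (e s))\<^sup>2) (at s within {0..})"
        using storage_derivative[OF C2 \<open>a > 0\<close> traj, of s] by (simp add: W_def[abs_def] e_def)
      have "0 \<le> (\<rho> * kd) * (norm (grad f (x1 s)))\<^sup>2" "0 \<le> a * (norm (e s))\<^sup>2"
        using pos by auto
      then show "- (\<rho> * kd) * (norm (grad f (x1 s)))\<^sup>2 - a * (norm (e s))\<^sup>2 \<le> 0"
        by simp
    qed
    then show ?thesis
      by (simp add: W_def V1_def algebra_simps)
  qed
  have nonneg: "0 \<le> \<rho> * gap f (x1 t)" "0 \<le> \<rho> * ki / (2 * a) * (norm (\<xi> t))\<^sup>2" "0 \<le> (norm (e t))\<^sup>2 / 2"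
    for t
    using pos gap_nonneg[OF bdd] by simp_all
  have "bounded (e ` {0..})"
  proof (rule bounded_image_if_norm_sq_le)
    show "(norm (e t))\<^sup>2 \<le> 2 * W 0" if "t \<in> {0..}" for t
      using W_le[of t] nonneg[of t] that by simp
  qed
  moreover have "bounded (\<xi> ` {0..})"
  proof (rule bounded_image_if_norm_sq_le)
    fix t :: real assume "t \<in> {0..}"
    then have "t \<ge> 0" by simp
    then have "(\<rho> * ki / (2 * a)) * (norm (\<xi> t))\<^sup>2 \<le> W 0"
      using W_le[of t] nonneg[of t] by linarith
    moreover have "\<rho> * ki / (2 * a) > 0"
      using pos by simp
    ultimately show "(norm (\<xi> t))\<^sup>2 \<le> W 0 / (\<rho> * ki / (2 * a))"
      by (subst pos_le_divide_eq) (auto simp: mult.commute)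
  qed
  moreover have "bounded ((\<lambda>t. grad f (x1 t)) ` {0..})"
  proof (rule bounded_image_if_norm_sq_le)
    fix t :: real assume "t \<in> {0..}"
    then have "t \<ge> 0" by simp
    then have "\<rho> * gap f (x1 t) \<le> W 0"
      using W_le[of t] nonneg[of t] by linarith
    then have "gap f (x1 t) \<le> W 0 / \<rho>"
      using \<open>\<rho> > 0\<close> by (simp add: field_simps)
    then have "4 * M * gap f (x1 t) \<le> 4 * M * (W 0 / \<rho>)"
      using \<open>M > 0\<close> by (intro mult_left_mono) auto
    then show "(norm (grad f (x1 t)))\<^sup>2 \<le> 4 * M * (W 0 / \<rho>)"
      using norm_grad_sq_le_gap[OF smooth \<open>M > 0\<close> bdd, of "x1 t"] by simp
  qed
  ultimately have "bounded ((\<lambda>t. e t + ((- kd) *\<^sub>R grad f (x1 t) - (ki / a) *\<^sub>R \<xi> t)) ` {0..})"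
    by (intro bounded_plus_comp bounded_minus_comp bounded_scaleR_comp)
  then show ?thesis
    by (simp add: e_def err_def alpha_def)
qed

lemma closed_loop_grad_tendsto_zero:
  assumes C2: "class_C2 f" and smooth: "L_smooth L f" and bdd: "bdd_below (range f)"
    and pos: "a > 0" "kd > 0" "ki > 0" "\<rho> > 0"
    and traj: "closed_loop_trajectory f a kd ki \<rho> {0..} x1 x2 \<xi>"
  shows "((\<lambda>t. grad f (x1 t)) \<longlongrightarrow> 0) at_top"
proof -
  \<comment> \<open>The size of the gradient step in \<open>norm_grad_sq_le_gap\<close> is a reciprocal of the smoothness
    constant, and \<open>L\<close> may be zero.\<close>
  define M where "M = max L 1"
  have smooth': "L_smooth M f" and "M > 0"
    using L_smooth_mono[OF smooth, of M] by (auto simp: M_def)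
  obtain B where "B > 0" and B: "\<And>t. t \<ge> 0 \<Longrightarrow> norm (x2 t) \<le> B"
    using closed_loop_velocity_bounded[OF C2 smooth' \<open>M > 0\<close> bdd pos traj]
    unfolding bounded_pos by auto
  have x1_lip: "norm (x1 s - x1 t) \<le> B * norm (s - t)" if "s \<in> {0..}" "t \<in> {0..}" for s t
  proof (rule differentiable_bound[OF _ _ _ that])
    show "convex {0::real..}" by (rule convex_real_interval)
    show "(x1 has_derivative (\<lambda>h. h *\<^sub>R x2 r)) (at r within {0..})" if "r \<in> {0..}" for r
      using traj that
      by (simp add: closed_loop_trajectory_def system_trajectory_def has_vector_derivative_def)
    show "onorm (\<lambda>h. h *\<^sub>R x2 r) \<le> B" if "r \<in> {0..}" for r :: real
      using B[of r] that \<open>B > 0\<close>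
      by (intro onorm_bound) (auto simp: mult.commute[of B] intro: mult_left_mono)
  qed
  have lip: "(M * B)-lipschitz_on {0..} (\<lambda>t. grad f (x1 t))"
  proof (rule lipschitz_onI)
    fix s t :: real assume st: "s \<in> {0..}" "t \<in> {0..}"
    have "norm (grad f (x1 s) - grad f (x1 t)) \<le> M * norm (x1 s - x1 t)"
      using smooth' by (simp add: L_smooth_def)
    also have "\<dots> \<le> M * (B * norm (s - t))"
      using x1_lip[OF st] \<open>M > 0\<close> by (intro mult_left_mono) auto
    finally show "dist (grad f (x1 s)) (grad f (x1 t)) \<le> M * B * dist s t"
      by (simp add: dist_norm)
  qed (use \<open>M > 0\<close> \<open>B > 0\<close> in simp)
  define e where "e s = err f a kd ki (x1 s) (x2 s) (\<xi> s)" for s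
  define W where "W s = V1 f a ki \<rho> (x1 s) (\<xi> s) + (norm (e s))\<^sup>2 / 2" for s
  have W_bdd: "bdd_below (W ` {0..})"
    using pos gap_nonneg[OF bdd] by (intro bdd_belowI2[where m = 0]) (simp add: W_def V1_def)
  show ?thesis
  proof (rule dissipated_signal_tendsto_zero[where c = "\<rho> * kd", OF _ _ _ W_bdd lip])
    fix t :: real assume "t \<ge> 0"
    then show "(W has_real_derivative
        - (\<rho> * kd) * (norm (grad f (x1 t)))\<^sup>2 - a * (norm (e t))\<^sup>2) (at t within {0..})"
      using storage_derivative[OF C2 \<open>a > 0\<close> traj, of t] by (simp add: W_def[abs_def] e_def)
    show "- (\<rho> * kd) * (norm (grad f (x1 t)))\<^sup>2 - a * (norm (e t))\<^sup>2
        \<le> - (\<rho> * kd) * (norm (grad f (x1 t)))\<^sup>2"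
      using \<open>a > 0\<close> by simp
  qed (use pos in simp)
qed

section \<open>The backstepping theorem\<close>

theorem theorem3:
  fixes f :: "real ^ 'n \<Rightarrow> real" and L a kd ki kp \<rho> :: real
  assumes "class_C2 f" and "convex_on UNIV f" and "L_smooth L f" and "bdd_below (range f)"
    and "a > 0" and "kd > 0" and "ki > 0"
    and "\<rho> = kp - a * kd - ki / a" and "\<rho> > 0"
  shows
    \<comment> \<open>(a)\<close>
    "(\<forall>T e x1 \<xi>. time_interval T \<longrightarrow> reduced_trajectory f a kd ki T e x1 \<xi> \<longrightarrow>
        (\<forall>t\<in>T. ((\<lambda>s. V1 f a ki \<rho> (x1 s) (\<xi> s)) has_real_derivative
            - \<rho> * kd * (norm (grad f (x1 t)))\<^sup>2 + \<rho> * (grad f (x1 t) \<bullet> e t)) (at t within T)))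
     \<and>
     (let c_phi = \<rho>; c_z = \<rho> * ki / (2 * a); \<sigma> = \<rho> * kd; lam = \<rho> in
        (\<forall>x1 \<xi>. V1 f a ki \<rho> x1 \<xi> \<ge> c_phi * gap f x1 + c_z * (norm \<xi>)\<^sup>2) \<and>
        (\<forall>T e x1 \<xi>. time_interval T \<longrightarrow> reduced_trajectory f a kd ki T e x1 \<xi> \<longrightarrow>
           (\<forall>t\<in>T. ((\<lambda>s. V1 f a ki \<rho> (x1 s) (\<xi> s)) has_real_derivative
               - \<sigma> * (norm (grad f (x1 t)))\<^sup>2 + lam * (grad f (x1 t) \<bullet> e t)) (at t within T))) \<and>
        local_lipschitz (UNIV :: real set) UNIV
          (\<lambda>_ (x1, \<xi> :: real ^ 'n). grad f x1) \<and>
        (\<forall>S. bounded ((\<lambda>(x1, \<xi>). (grad f x1, \<xi>)) ` S) \<longrightarrow>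
             bounded ((\<lambda>(x1, \<xi>). alpha f a kd ki x1 \<xi>) ` S)))
     \<and> \<comment> \<open>(b)\<close>
     (\<forall>T u x1 x2 \<xi>. time_interval T \<longrightarrow> system_trajectory f T u x1 x2 \<xi> \<longrightarrow>
        (\<forall>t\<in>T. ((\<lambda>s. alpha f a kd ki (x1 s) (\<xi> s)) has_vector_derivative
            alpha_dot f a kd ki (x1 t) (x2 t) (\<xi> t)) (at t within T)))
     \<and>
     (\<forall>x1 x2 \<xi>. feedback f a kd ki \<rho> x1 x2 \<xi> =
        - a *\<^sub>R x2 - kp *\<^sub>R grad f x1 - ki *\<^sub>R \<xi> - kd *\<^sub>R (hessian f x1 *v x2))
     \<and>
     (\<forall>T X. time_interval T \<longrightarrow>
        ((\<exists>x2 \<xi>. closed_loop_trajectory f a kd ki \<rho> T X x2 \<xi> \<and> \<xi> 0 = 0) \<longleftrightarrow>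
         pid_solution f a kp ki kd T X))
     \<and> \<comment> \<open>(c)\<close>
     (\<forall>x1 x2 \<xi>. closed_loop_trajectory f a kd ki \<rho> {0..} x1 x2 \<xi> \<longrightarrow>
        ((\<lambda>t. grad f (x1 t)) \<longlongrightarrow> 0) at_top)"
proof (unfold Let_def, intro conjI)
  note V1' = V1_derivative[OF assms(1,5), of kd ki _ _ _ _ _ \<rho>]
  show "\<forall>T e x1 \<xi>. time_interval T \<longrightarrow> reduced_trajectory f a kd ki T e x1 \<xi> \<longrightarrow>
        (\<forall>t\<in>T. ((\<lambda>s. V1 f a ki \<rho> (x1 s) (\<xi> s)) has_real_derivative
            - \<rho> * kd * (norm (grad f (x1 t)))\<^sup>2 + \<rho> * (grad f (x1 t) \<bullet> e t)) (at t within T))"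
    using V1' by blast
  then show "\<forall>T e x1 \<xi>. time_interval T \<longrightarrow> reduced_trajectory f a kd ki T e x1 \<xi> \<longrightarrow>
        (\<forall>t\<in>T. ((\<lambda>s. V1 f a ki \<rho> (x1 s) (\<xi> s)) has_real_derivative
            - (\<rho> * kd) * (norm (grad f (x1 t)))\<^sup>2 + \<rho> * (grad f (x1 t) \<bullet> e t)) (at t within T))"
    by simp
  show "\<forall>x1 \<xi>. V1 f a ki \<rho> x1 \<xi> \<ge> \<rho> * gap f x1 + \<rho> * ki / (2 * a) * (norm \<xi>)\<^sup>2"
    by (simp add: V1_def algebra_simps)
  show "local_lipschitz (UNIV :: real set) UNIV (\<lambda>_ (x1, \<xi> :: real ^ 'n). grad f x1)"
    by (rule local_lipschitz_grad[OF assms(3)])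
  show "\<forall>S. bounded ((\<lambda>(x1, \<xi>). (grad f x1, \<xi>)) ` S) \<longrightarrow>
      bounded ((\<lambda>(x1, \<xi>). alpha f a kd ki x1 \<xi>) ` S)"
    using bounded_alpha by blast
  show "\<forall>T u x1 x2 \<xi>. time_interval T \<longrightarrow> system_trajectory f T u x1 x2 \<xi> \<longrightarrow>
        (\<forall>t\<in>T. ((\<lambda>s. alpha f a kd ki (x1 s) (\<xi> s)) has_vector_derivative
            alpha_dot f a kd ki (x1 t) (x2 t) (\<xi> t)) (at t within T))"
    unfolding system_trajectory_def by (blast intro: alpha_has_vector_derivative[OF assms(1)])
  show "\<forall>x1 x2 \<xi>. feedback f a kd ki \<rho> x1 x2 \<xi> =
        - a *\<^sub>R x2 - kp *\<^sub>R grad f x1 - ki *\<^sub>R \<xi> - kd *\<^sub>R (hessian f x1 *v x2)"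
    using feedback_eq[OF assms(1,5,8)] by blast
  show "\<forall>T X. time_interval T \<longrightarrow>
        ((\<exists>x2 \<xi>. closed_loop_trajectory f a kd ki \<rho> T X x2 \<xi> \<and> \<xi> 0 = 0) \<longleftrightarrow>
         pid_solution f a kp ki kd T X)"
    using closed_loop_iff_pid_solution[OF assms(1,5,8)] by blast
  show "\<forall>x1 x2 \<xi>. closed_loop_trajectory f a kd ki \<rho> {0..} x1 x2 \<xi> \<longrightarrow>
        ((\<lambda>t. grad f (x1 t)) \<longlongrightarrow> 0) at_top"
    using closed_loop_grad_tendsto_zero[OF assms(1,3,4,5,6,7,9)] by blast
qed

end
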